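(* Let $(n_k)_{k\ge1}$ be a strictly increasing sequence of positive integers. Suppose that there exists a strictly increasing sequence $(m_k)_{k\ge1}$ of integers such that $$n_{k+1}-2\sum_{j=1}^k m_jn_j\ge 1\quad\text{for each } k\ge1,$$ and $$n_{k+1}-2\sum_{j=1}^k m_jn_j\longrightarrow+\infty\quad\text{as } k\to+\infty.$$ For each $k\ge1$, let $p_k\ge1$ be an integer such that $p_k\pi\le m_k+2$. Then there exists a continuous generalized Riesz product $\sigma$ on $\mathbb{T}$ such that for every non-empty finite subset $F$ of $\mathbb{N}=\{1,2,\dots\}$ and all integers $j_k\in\{1,\dots,p_k\}$, $k\in F$, one has $$\hat\sigma\Bigl(\sum_{k\in F}j_kn_k\Bigr)\ge\prod_{k\in F}\Bigl(1-3\pi^2\Bigl(\frac{p_k}{m_k+2}\Bigr)^2\Bigr)$$ and $$\hat\sigma\Bigl(\sum_{k\in F}n_k\Bigr)=\prod_{k\in F}\cos\Bigl(\frac{\pi}{m_k+2}\Bigr).$$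
   Context: $\mathbb{T}=\{\lambda\in\mathbb{C}: |\lambda|=1\}$. For a Borel probability measure $\sigma$ on $\mathbb{T}$ and $n\in\mathbb{Z}$, $\hat\sigma(n)=\int_{\mathbb{T}}\lambda^n\,d\sigma(\lambda)$. A measure is continuous if it has no atoms. A generalized Riesz product on $\mathbb{T}$ is a probability measure that is the weak-$*$ limit, as $N\to+\infty$, of the measures $\prod_{k=1}^N P_k(\lambda^{a_k})\,dm(\lambda)$, where $m$ is the normalized Lebesgue measure on $\mathbb{T}$, each $P_k$ is a trigonometric polynomial of degree $d_k$ (spectrum contained in $\{-d_k,\dots,d_k\}$) which is nonnegative on $\mathbb{T}$ and has constant Fourier coefficient $\hat P_k(0)=1$, and $(a_k)_{k\ge1}$ is a strictly increasing sequence of positive integers satisfying the dissociation condition $a_{k+1}-2\sum_{j=1}^k d_ja_j\ge 1$ for each $k\ge1$.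
   Formalization: In the product lower bound each factor 1−3π²(p_k/(m_k+2))² is replaced by its positive part, since the literal bound fails when two factors are near −2 (e.g. m_1=20, p_1=7, m_2=42, p_2=14 gives a bound above 1). *)

theory Defs
  imports "HOL-Analysis.Analysis" "HOL-Probability.Probability"
begin

abbreviation unit_circle :: "complex set" where
  "unit_circle \<equiv> sphere 0 1"

abbreviation circle_borel :: "complex measure" where
  "circle_borel \<equiv> restrict_space borel unit_circle"

definition circle_lebesgue :: "complex measure" where
  "circle_lebesgue = distr (uniform_measure lborel {0..2 * pi}) circle_borel cis"

definition circle_prob_measure :: "complex measure \<Rightarrow> bool" where
  "circle_prob_measure \<sigma> \<longleftrightarrow> prob_space \<sigma> \<and> sets \<sigma> = sets circle_borel"

(* The sign convention is that of characteristic functions: the integrand is z^n,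
   not z^(-n). *)
definition fourier_coeff :: "complex measure \<Rightarrow> int \<Rightarrow> complex" where
  "fourier_coeff \<sigma> n = (\<integral>z. z powi n \<partial>\<sigma>)"

definition continuous_measure :: "complex measure \<Rightarrow> bool" where
  "continuous_measure \<sigma> \<longleftrightarrow> (\<forall>z\<in>space \<sigma>. emeasure \<sigma> {z} = 0)"

definition weak_star_limit :: "(nat \<Rightarrow> complex measure) \<Rightarrow> complex measure \<Rightarrow> bool" where
  "weak_star_limit \<mu> \<sigma> \<longleftrightarrow>
     (\<forall>f :: complex \<Rightarrow> complex. continuous_on unit_circle f \<longrightarrow>
        (\<lambda>N. \<integral>z. f z \<partial>(\<mu> N)) \<longlonglongrightarrow> (\<integral>z. f z \<partial>\<sigma>))"

(* The trigonometric polynomial with Fourier coefficients c j, -d <= j <= d;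
   only these values of c matter. *)
definition trig_poly :: "nat \<Rightarrow> (int \<Rightarrow> complex) \<Rightarrow> complex \<Rightarrow> complex" where
  "trig_poly d c z = (\<Sum>j\<in>{- int d..int d}. c j * z powi j)"

(* Re only serves to give the density the right type: the factors are required to be
   nonnegative reals on the circle. *)
definition riesz_partial_product ::
  "(nat \<Rightarrow> nat) \<Rightarrow> (nat \<Rightarrow> int \<Rightarrow> complex) \<Rightarrow> (nat \<Rightarrow> int) \<Rightarrow> nat \<Rightarrow> complex measure" where
  "riesz_partial_product d c a N =
     density circle_lebesgue (\<lambda>z. ennreal (\<Prod>k=1..N. Re (trig_poly (d k) (c k) (z powi a k))))"

(* Sequences are indexed by k >= 1; values at index 0 are irrelevant. *)
definition generalized_riesz_product :: "complex measure \<Rightarrow> bool" where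
  "generalized_riesz_product \<sigma> \<longleftrightarrow>
     circle_prob_measure \<sigma> \<and>
     (\<exists>(d :: nat \<Rightarrow> nat) (c :: nat \<Rightarrow> int \<Rightarrow> complex) (a :: nat \<Rightarrow> int).
        (\<forall>k\<ge>1. \<forall>z\<in>unit_circle. trig_poly (d k) (c k) z \<in> \<real>\<^sub>\<ge>\<^sub>0) \<and>
        (\<forall>k\<ge>1. c k 0 = 1) \<and>
        strict_mono_on {1..} a \<and>
        (\<forall>k\<ge>1. a k > 0) \<and>
        (\<forall>k\<ge>1. a (k + 1) - 2 * (\<Sum>j=1..k. int (d j) * a j) \<ge> 1) \<and>
        weak_star_limit (riesz_partial_product d c a) \<sigma>)"

(* On the lower bound for the Fourier coefficients in the theorem: the bounds
   1 - 3 pi^2 (p/(m+2))^2 for the individual factors may be negative (p pi <= m + 2 only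
   gives a value >= -2), and then their product is not a lower bound for the product of
   the factors: with m = 20, p = 7 and m = 42, p = 14 each is about -1.998, so their product
   exceeds 1, whereas a probability measure has Fourier coefficients of modulus at most 1.
   Each bound is therefore replaced by its positive part in the product. *)

end

theory Submission
  imports Defs
begin

text \<open>Take for \<open>P k\<close> the squared modulus of the polynomial with coefficients proportional to
  \<open>sin ((i + 1) * pi / (m k + 2))\<close>. Its coefficients have a closed form, whose first value is
  \<open>cos (pi / (m k + 2))\<close> and whose \<open>j\<close>-th value is at least \<open>cos (j * pi / (m k + 2))\<close>.

  By dissociation, multiplying by the next factor replaces the spectrum by a union of disjoint
  translates of it, so the Fourier coefficients of the partial products are products of coefficients of the
  \<open>P k\<close>, and each of them is eventually constant. Helly's theorem (through the argument map) and
  Stone-Weierstrass turn this into weak-star convergence. The spectrum of the limit has gaps of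
  length \<open>n (k + 1) - 2 * (\<Sum>j=1..k. m j * n j) - 1\<close>, and a measure with arbitrarily long gaps
  has no atoms.\<close>

section \<open>Measures on the circle\<close>

lemma space_circle_borel [simp]: "space circle_borel = unit_circle"
  by (simp add: space_restrict_space)

lemma borel_measurable_circle:
  fixes f :: "complex \<Rightarrow> 'a::topological_space"
  assumes "continuous_on unit_circle f" "sets \<mu> = sets circle_borel"
  shows "f \<in> borel_measurable \<mu>"
  using borel_measurable_continuous_on_restrict[OF assms(1)] measurable_cong_sets[OF assms(2) refl]
  by blast

lemma circle_prob_measure_space:
  "circle_prob_measure \<mu> \<Longrightarrow> space \<mu> = unit_circle"
  unfolding circle_prob_measure_def using sets_eq_imp_space_eq space_circle_borel by metis

lemma bounded_on_circle:
  fixes f :: "complex \<Rightarrow> 'a::real_normed_vector"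
  assumes "continuous_on unit_circle f"
  obtains B where "\<And>z. cmod z = 1 \<Longrightarrow> norm (f z) \<le> B"
proof -
  have "bounded (f ` unit_circle)"
    by (intro compact_imp_bounded compact_continuous_image assms) simp
  then show ?thesis
    using that unfolding bounded_iff by (metis image_eqI mem_sphere_0)
qed

lemma integrable_circle:
  fixes f :: "complex \<Rightarrow> 'a::{banach, second_countable_topology}"
  assumes "circle_prob_measure \<mu>" "continuous_on unit_circle f"
  shows "integrable \<mu> f"
proof -
  interpret prob_space \<mu> using assms(1) by (simp add: circle_prob_measure_def)
  obtain B where B: "\<And>z. cmod z = 1 \<Longrightarrow> norm (f z) \<le> B"
    using bounded_on_circle[OF assms(2)] by blast
  show ?thesis
  proof (rule integrable_const_bound[where B = B])
    show "AE z in \<mu>. norm (f z) \<le> B"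
      using B circle_prob_measure_space[OF assms(1)] by (intro AE_I2) auto
    show "f \<in> borel_measurable \<mu>"
      using assms by (intro borel_measurable_circle) (auto simp: circle_prob_measure_def)
  qed
qed

lemma continuous_on_circle_powi [continuous_intros]:
  "continuous_on unit_circle (\<lambda>z::complex. z powi s)"
  by (intro continuous_intros) auto

section \<open>Transport between the circle and the real line\<close>

lemma measurable_cis [measurable]: "cis \<in> borel \<rightarrow>\<^sub>M circle_borel"
  by (intro measurable_restrict_space2 borel_measurable_continuous_onI continuous_intros) auto

text \<open>\<open>Arg\<close> jumps at \<open>-1\<close>, so continuity alone does not suffice. On
  the circle it is \<open>arccos (Re z)\<close> up to a sign read off from \<open>Im z\<close>; at
  \<open>-1\<close> the nonnegative branch gives \<open>pi\<close>, as \<open>Arg\<close>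
  does.\<close>

lemma measurable_Arg_circle: "Arg \<in> borel_measurable circle_borel"
proof -
  have "(\<lambda>z. if 0 \<le> Im z then arccos (Re z) else - arccos (Re z)) \<in> borel_measurable circle_borel"
  proof (rule measurable_If)
    have "-1 \<le> Re z \<and> Re z \<le> 1" if "z \<in> unit_circle" for z
      using that abs_Re_le_cmod[of z] by auto
    then have "continuous_on unit_circle (\<lambda>z. arccos (Re z))"
      by (intro continuous_intros) auto
    then show m: "(\<lambda>z. arccos (Re z)) \<in> borel_measurable circle_borel"
      by (rule borel_measurable_circle) simp
    then show "(\<lambda>z. - arccos (Re z)) \<in> borel_measurable circle_borel"
      by simp
    have "Im \<in> borel_measurable circle_borel"
      by (intro borel_measurable_circle continuous_intros) simp
    from measurable_sets[OF this, of "{0..}"]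
    show "{z \<in> space circle_borel. 0 \<le> Im z} \<in> sets circle_borel"
      by (simp add: vimage_def Int_def conj_commute)
  qed
  moreover have "(if 0 \<le> Im z then arccos (Re z) else - arccos (Re z)) = Arg z"
    if "z \<in> space circle_borel" for z
  proof -
    have "cis (Arg z) = z"
      using that cis_Arg[of z] by (cases "z = 0") (auto simp: sgn_eq)
    then have "Re z = cos (Arg z)" "Im z = sin (Arg z)"
      by (metis cis.sel(1), metis cis.sel(2))
    moreover have "0 \<le> sin t \<longleftrightarrow> 0 \<le> t" "arccos (cos t) = \<bar>t\<bar>" if t: "-pi < t" "t \<le> pi" for t
    proof -
      show "0 \<le> sin t \<longleftrightarrow> 0 \<le> t"
        using t sin_ge_zero[of t] sin_gt_zero[of "-t"] by (cases "0 \<le> t") (linarith, simp)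
      show "arccos (cos t) = \<bar>t\<bar>"
        using t arccos_cos[of "\<bar>t\<bar>"] by (metis abs_ge_zero abs_le_iff cos_abs_real less_imp_le minus_le_iff)
    qed
    ultimately show ?thesis
      using Arg_bounded[of z] by (smt (verit))
  qed
  ultimately show ?thesis
    by (subst (asm) measurable_cong) auto
qed

text \<open>Since \<open>cis\<close> undoes \<open>Arg\<close> on the circle, nothing is lost by
  passing to the law of the argument, where compactness theorems for distributions on the line
  apply.\<close>

lemma circle_prob_measure_eq_distr_cis:
  assumes "circle_prob_measure \<mu>"
  shows "\<mu> = distr (distr \<mu> borel Arg) circle_borel cis"
proof -
  have s: "sets \<mu> = sets circle_borel"
    using assms by (simp add: circle_prob_measure_def)
  have m: "Arg \<in> borel_measurable \<mu>"
    using measurable_Arg_circle measurable_cong_sets[OF s refl] by blast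
  have "distr \<mu> circle_borel (cis \<circ> Arg) = distr \<mu> \<mu> (\<lambda>z. z)"
  proof (rule distr_cong)
    fix z assume "z \<in> space \<mu>"
    then have "cmod z = 1" "z \<noteq> 0" using circle_prob_measure_space[OF assms] by auto
    then show "(cis \<circ> Arg) z = z" using cis_Arg[of z] by (simp add: sgn_eq)
  qed (use s in simp_all)
  then show ?thesis
    using m by (simp add: distr_distr)
qed

lemma circle_prob_measure_distr_cis:
  assumes "real_distribution M"
  shows "circle_prob_measure (distr M circle_borel cis)"
proof -
  interpret real_distribution M by fact
  show ?thesis
    unfolding circle_prob_measure_def by (auto intro!: prob_space_distr)
qed

lemma integral_distr_cis:
  fixes f :: "complex \<Rightarrow> complex"
  assumes "sets M = sets borel" "continuous_on unit_circle f"
  shows "(\<integral>z. f z \<partial>distr M circle_borel cis) = (\<integral>t. f (cis t) \<partial>M)"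
proof (rule integral_distr)
  show "cis \<in> M \<rightarrow>\<^sub>M circle_borel"
    using measurable_cis measurable_cong_sets[OF assms(1) refl] by blast
qed (use assms in \<open>simp add: borel_measurable_circle\<close>)

text \<open>Helly's theorem: the laws of \<open>Arg\<close> live in \<open>{-pi<..pi}\<close>, hence
  are tight. The limit on the line may charge \<open>-pi\<close>, but pushing forward by
  \<open>cis\<close> glues the two ends, and each \<open>f (cis t)\<close> is a bounded continuous
  test function on the line.\<close>

lemma circle_weak_star_compact:
  fixes \<mu> :: "nat \<Rightarrow> complex measure"
  assumes "\<And>N. circle_prob_measure (\<mu> N)"
  obtains r \<sigma> where "strict_mono r" "circle_prob_measure \<sigma>" "weak_star_limit (\<mu> \<circ> r) \<sigma>"
proof -
  define \<nu> where "\<nu> N = distr (\<mu> N) borel Arg" for N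
  have sets: "sets (\<mu> N) = sets circle_borel" for N
    using assms by (simp add: circle_prob_measure_def)
  have m: "Arg \<in> borel_measurable (\<mu> N)" for N
    using measurable_Arg_circle measurable_cong_sets[OF sets refl] by blast
  have \<nu>: "real_distribution (\<nu> N)" for N
    unfolding \<nu>_def real_distribution_def real_distribution_axioms_def
    using m assms by (auto simp: circle_prob_measure_def intro: prob_space.prob_space_distr)
  have \<mu>\<nu>: "\<mu> N = distr (\<nu> N) circle_borel cis" for N
    unfolding \<nu>_def by (rule circle_prob_measure_eq_distr_cis) (rule assms)
  have "tight \<nu>"
    unfolding tight_def
  proof (intro conjI allI impI)
    fix \<epsilon> :: real assume "\<epsilon> > 0"
    have "measure (\<nu> N) {-pi<..pi} = 1" for N
    proof -
      interpret prob_space "\<mu> N" using assms by (simp add: circle_prob_measure_def)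
      have "Arg -` {-pi<..pi} \<inter> space (\<mu> N) = space (\<mu> N)"
        using Arg_bounded by auto
      then show ?thesis
        unfolding \<nu>_def by (subst measure_distr) (auto simp: m prob_space)
    qed
    then show "\<exists>a b. a < b \<and> (\<forall>n. 1 - \<epsilon> < measure (\<nu> n) {a<..b})"
      using \<open>\<epsilon> > 0\<close> by (intro exI[of _ "-pi"] exI[of _ pi]) auto
  qed (rule \<nu>)
  then obtain r M where r: "strict_mono (r::nat \<Rightarrow> nat)" and M: "real_distribution M"
    and w: "weak_conv_m (\<nu> \<circ> r) M"
    using tight_imp_convergent_subsubsequence[of \<nu> id] by (auto simp: strict_mono_def)
  show ?thesis
  proof
    show "circle_prob_measure (distr M circle_borel cis)"
      using M by (rule circle_prob_measure_distr_cis)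
    show "weak_star_limit (\<mu> \<circ> r) (distr M circle_borel cis)"
      unfolding weak_star_limit_def
    proof (intro allI impI)
      fix f :: "complex \<Rightarrow> complex" assume f: "continuous_on unit_circle f"
      obtain B where B: "\<And>z. cmod z = 1 \<Longrightarrow> norm (f z) \<le> B"
        using bounded_on_circle[OF f] by blast
      have "continuous_on UNIV (\<lambda>t. f (cis t))"
        by (rule continuous_on_compose2[OF f]) (auto intro!: continuous_intros)
      then have "(\<lambda>N. \<integral>t. f (cis t) \<partial>(\<nu> \<circ> r) N) \<longlonglongrightarrow> (\<integral>t. f (cis t) \<partial>M)"
        using B \<nu> M w
        by (intro weak_conv_imp_integral_bdd_continuous_conv[where B = B])
           (auto simp: continuous_on_eq_continuous_at o_def)
      moreover have "(\<integral>z. f z \<partial>(\<mu> \<circ> r) N) = (\<integral>t. f (cis t) \<partial>(\<nu> \<circ> r) N)" for N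
        unfolding o_def by (subst \<mu>\<nu>) (intro integral_distr_cis f, simp add: \<nu>_def)
      moreover have "(\<integral>z. f z \<partial>distr M circle_borel cis) = (\<integral>t. f (cis t) \<partial>M)"
        using real_distribution.events_eq_borel[OF M] by (intro integral_distr_cis f)
      ultimately show "(\<lambda>N. \<integral>z. f z \<partial>(\<mu> \<circ> r) N) \<longlonglongrightarrow> (\<integral>z. f z \<partial>distr M circle_borel cis)"
        by simp
    qed
  qed (rule r)
qed

section \<open>Fourier coefficients and weak-star limits\<close>

text \<open>Trigonometric polynomials, generated inductively so that properties follow by rule
  induction. Rule \<open>cong\<close> admits identities valid only on the circle, such as
  \<open>z powi (-1) = cnj z\<close>, and avoids the exceptional point \<open>0\<close> of the power
  laws.\<close>

inductive trig_fun :: "(complex \<Rightarrow> complex) \<Rightarrow> bool" where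
  monomial: "trig_fun (\<lambda>z. c * z powi s)"
| add: "trig_fun f \<Longrightarrow> trig_fun g \<Longrightarrow> trig_fun (\<lambda>z. f z + g z)"
| cong: "trig_fun f \<Longrightarrow> (\<And>z. cmod z = 1 \<Longrightarrow> f z = g z) \<Longrightarrow> trig_fun g"

lemma trig_fun_mult:
  assumes "trig_fun f" "trig_fun g"
  shows "trig_fun (\<lambda>z. f z * g z)"
  using assms
proof (induction arbitrary: g rule: trig_fun.induct)
  case (monomial c s)
  then show ?case
  proof (induction rule: trig_fun.induct)
    case (monomial d t)
    show ?case
      by (rule trig_fun.cong[OF trig_fun.monomial[of "c * d" "s + t"]])
         (subst power_int_add, auto)
  next
    case (add f g)
    then show ?case
      using trig_fun.add by (simp add: ring_distribs)
  next
    case (cong f g)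
    show ?case
      by (rule trig_fun.cong[OF cong.IH]) (simp add: cong.hyps)
  qed
next
  case (add f h)
  then show ?case
    using trig_fun.add by (simp add: ring_distribs)
next
  case (cong f h)
  show ?case
    by (rule trig_fun.cong[OF cong.IH[OF cong.prems]]) (simp add: cong.hyps)
qed

lemma trig_fun_real_polynomial_function:
  fixes g :: "complex \<Rightarrow> real"
  assumes "real_polynomial_function g"
  shows "trig_fun (\<lambda>z. of_real (g z))"
  using assms
proof (induction rule: real_polynomial_function.induct)
  case (linear f)
  interpret bounded_linear f by fact
  \<comment> \<open>A real-linear \<open>f\<close> is \<open>a * Re z + b * Im z\<close>. Inserting
    \<open>Re z = (z + 1/z) / 2\<close> and \<open>Im z = (z - 1/z) / (2 * \<i>)\<close> produces
    the two coefficients below.\<close>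
  define a b :: complex where "a = f 1" and "b = f \<i>"
  show ?case
  proof (rule trig_fun.cong)
    show "trig_fun (\<lambda>z. (a - \<i> * b) / 2 * z powi 1 + (a + \<i> * b) / 2 * z powi (-1))"
      by (intro trig_fun.intros)
  next
    fix z assume "cmod z = 1"
    then have inv: "z powi (-1) = cnj z"
      using complex_mult_cnj[of z] by (simp add: power_int_minus inverse_unique cmod_def)
    have "f z = Re z * f 1 + Im z * f \<i>"
    proof -
      have "f z = f (Re z *\<^sub>R 1 + Im z *\<^sub>R \<i>)"
        by (rule arg_cong[of _ _ f]) (simp add: complex_eq_iff)
      then show ?thesis
        by (simp only: add scaleR real_scaleR_def)
    qed
    then show "(a - \<i> * b) / 2 * z powi 1 + (a + \<i> * b) / 2 * z powi (-1) = of_real (f z)"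
      unfolding inv by (simp add: a_def b_def complex_eq_iff field_simps)
  qed
next
  case (const c)
  show ?case
    using trig_fun.monomial[of "of_real c" 0] by simp
next
  case (add f g)
  show ?case
    using trig_fun.add[OF add.IH] by simp
next
  case (mult f g)
  show ?case
    using trig_fun_mult[OF mult.IH] by simp
qed

lemma continuous_on_trig_fun: "trig_fun f \<Longrightarrow> continuous_on unit_circle f"
proof (induction rule: trig_fun.induct)
  case (cong f g)
  then show ?case
    using continuous_on_cong[of unit_circle unit_circle f g] by simp
qed (auto intro!: continuous_intros)

text \<open>Stone-Weierstrass gives polynomials in \<open>Re z\<close> and \<open>Im z\<close>;
  restricted to the circle these are trigonometric polynomials.\<close>

lemma trig_fun_approx:
  fixes f :: "complex \<Rightarrow> complex"
  assumes "continuous_on unit_circle f" "e > 0"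
  obtains g where "trig_fun g" "\<And>z. cmod z = 1 \<Longrightarrow> cmod (f z - g z) < e"
proof -
  obtain g where g: "polynomial_function g" "\<And>z. z \<in> unit_circle \<Longrightarrow> cmod (f z - g z) < e"
    using Stone_Weierstrass_polynomial_function[OF _ assms] by auto
  have "real_polynomial_function (Re \<circ> g)" "real_polynomial_function (Im \<circ> g)"
    using g(1) bounded_linear_Re bounded_linear_Im by (simp_all add: polynomial_function_def)
  then have "trig_fun (\<lambda>z. of_real (Re (g z)) + (\<i> * z powi 0) * of_real (Im (g z)))"
    using trig_fun_real_polynomial_function[of "Re \<circ> g"] trig_fun_real_polynomial_function[of "Im \<circ> g"]
    by (intro trig_fun.add trig_fun_mult trig_fun.monomial) auto
  then have "trig_fun g"
    by (rule trig_fun.cong) (simp add: complex_eq_iff)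
  then show ?thesis
    using g(2) that by simp
qed

text \<open>Linearity extends the convergence from monomials to trigonometric polynomials. Replacing
  \<open>f\<close> by an approximant costs at most \<open>e / 4\<close> under any probability
  measure, so the two replacements and the convergence error stay below \<open>e\<close>.\<close>

lemma weak_star_limitI:
  assumes \<mu>: "\<And>N. circle_prob_measure (\<mu> N)" and \<sigma>: "circle_prob_measure \<sigma>"
    and lim: "\<And>s. (\<lambda>N. fourier_coeff (\<mu> N) s) \<longlonglongrightarrow> fourier_coeff \<sigma> s"
  shows "weak_star_limit \<mu> \<sigma>"
proof -
  have trig: "(\<lambda>N. \<integral>z. g z \<partial>\<mu> N) \<longlonglongrightarrow> (\<integral>z. g z \<partial>\<sigma>)" if "trig_fun g" for g
    using that
  proof (induction rule: trig_fun.induct)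
    case (monomial c s)
    then show ?case
      using lim[of s] by (simp add: fourier_coeff_def tendsto_mult_left)
  next
    case (add f g)
    then show ?case
      using \<mu> \<sigma> by (simp add: integrable_circle continuous_on_trig_fun tendsto_add)
  next
    case (cong f g)
    have "(\<integral>z. g z \<partial>\<nu>) = (\<integral>z. f z \<partial>\<nu>)" if "circle_prob_measure \<nu>" for \<nu>
      using cong.hyps(2) circle_prob_measure_space[OF that]
      by (intro Bochner_Integration.integral_cong) auto
    then show ?case
      using cong.IH \<mu> \<sigma> by simp
  qed
  show ?thesis
    unfolding weak_star_limit_def
  proof (intro allI impI LIMSEQ_I)
    fix f :: "complex \<Rightarrow> complex" and e :: real
    assume f: "continuous_on unit_circle f" and "e > 0"
    obtain g where g: "trig_fun g" "\<And>z. cmod z = 1 \<Longrightarrow> cmod (f z - g z) < e / 4"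
      using trig_fun_approx[OF f, of "e / 4"] \<open>e > 0\<close> by auto
    have close: "cmod ((\<integral>z. f z \<partial>\<nu>) - (\<integral>z. g z \<partial>\<nu>)) \<le> e / 4" if \<nu>: "circle_prob_measure \<nu>" for \<nu>
    proof -
      interpret prob_space \<nu> using \<nu> by (simp add: circle_prob_measure_def)
      have int: "integrable \<nu> f" "integrable \<nu> g"
        using \<nu> f g continuous_on_trig_fun by (auto intro: integrable_circle)
      then have "(\<integral>z. f z \<partial>\<nu>) - (\<integral>z. g z \<partial>\<nu>) = (\<integral>z. f z - g z \<partial>\<nu>)"
        by simp
      also have "cmod \<dots> \<le> (\<integral>z. e / 4 \<partial>\<nu>)"
      proof (rule Bochner_Integration.integral_norm_bound_integral)
        show "cmod (f z - g z) \<le> e / 4" if "z \<in> space \<nu>" for z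
          using g(2)[of z] that circle_prob_measure_space[OF \<nu>] by auto
      qed (use int in auto)
      finally show ?thesis
        by (simp add: prob_space)
    qed
    obtain N0 where N0: "cmod ((\<integral>z. g z \<partial>\<mu> N) - (\<integral>z. g z \<partial>\<sigma>)) < e / 4" if "N \<ge> N0" for N
      using LIMSEQ_D[OF trig[OF g(1)], of "e / 4"] \<open>e > 0\<close> by auto
    show "\<exists>N0. \<forall>N\<ge>N0. cmod ((\<integral>z. f z \<partial>\<mu> N) - (\<integral>z. f z \<partial>\<sigma>)) < e"
    proof (intro exI allI impI)
      fix N assume "N \<ge> N0"
      let ?I = "\<lambda>h \<nu>. \<integral>z. h z \<partial>\<nu>"
      have "?I f (\<mu> N) - ?I f \<sigma> = (?I f (\<mu> N) - ?I g (\<mu> N)) + (?I g (\<mu> N) - ?I g \<sigma>) - (?I f \<sigma> - ?I g \<sigma>)"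
        by simp
      also have "cmod \<dots> \<le> cmod (?I f (\<mu> N) - ?I g (\<mu> N)) + cmod (?I g (\<mu> N) - ?I g \<sigma>) + cmod (?I f \<sigma> - ?I g \<sigma>)"
        by (intro order.trans[OF norm_triangle_ineq4] add_right_mono norm_triangle_ineq)
      finally show "cmod (?I f (\<mu> N) - ?I f \<sigma>) < e"
        using close[OF \<mu>, of N] close[OF \<sigma>] N0[OF \<open>N \<ge> N0\<close>] \<open>e > 0\<close> by linarith
    qed
  qed
qed

lemma weak_star_limit_fourier_coeff:
  "weak_star_limit \<mu> \<sigma> \<Longrightarrow> (\<lambda>N. fourier_coeff (\<mu> N) s) \<longlonglongrightarrow> fourier_coeff \<sigma> s"
  unfolding weak_star_limit_def fourier_coeff_def using continuous_on_circle_powi by blast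

text \<open>Compactness yields a limit along a subsequence only. As every coefficient converges
  along the whole sequence, its limit must be that of the subsequential limit measure.\<close>

lemma ex_weak_star_limit:
  assumes \<mu>: "\<And>N. circle_prob_measure (\<mu> N)"
    and conv: "\<And>s. convergent (\<lambda>N. fourier_coeff (\<mu> N) s)"
  obtains \<sigma> where "circle_prob_measure \<sigma>" "weak_star_limit \<mu> \<sigma>"
proof -
  obtain r \<sigma> where r: "strict_mono r" "circle_prob_measure \<sigma>" "weak_star_limit (\<mu> \<circ> r) \<sigma>"
    by (rule circle_weak_star_compact[OF \<mu>])
  have "(\<lambda>N. fourier_coeff (\<mu> N) s) \<longlonglongrightarrow> fourier_coeff \<sigma> s" for s
  proof -
    obtain l where l: "(\<lambda>N. fourier_coeff (\<mu> N) s) \<longlonglongrightarrow> l"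
      using conv[of s] by (auto simp: convergent_def)
    then have "(\<lambda>N. fourier_coeff ((\<mu> \<circ> r) N) s) \<longlonglongrightarrow> l"
      using LIMSEQ_subseq_LIMSEQ[OF l r(1)] by (simp add: o_def)
    then show ?thesis
      using l LIMSEQ_unique[OF weak_star_limit_fourier_coeff[OF r(3)]] by simp
  qed
  then show ?thesis
    using that[OF r(2) weak_star_limitI[OF \<mu> r(2)]] by blast
qed

text \<open>For \<open>q = z / w\<close> different from \<open>1\<close> the geometric sums stay
  bounded by \<open>2 / cmod (1 - q)\<close>, so their averages vanish in the limit.\<close>

lemma circle_average_tendsto_indicator:
  fixes z w :: complex
  assumes "cmod z = 1" "cmod w = 1"
  shows "(\<lambda>L. (\<Sum>l\<le>L. (z / w) ^ l) / of_nat (Suc L)) \<longlonglongrightarrow> indicator {w} z"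
proof (cases "z = w")
  case True
  then show ?thesis
    using assms(2) by (simp add: power_one_over[symmetric] divide_self_if del: of_nat_Suc) auto
next
  case False
  define q where "q = z / w"
  have q: "cmod q = 1" "q \<noteq> 1" "w \<noteq> 0"
    using assms False by (auto simp: q_def norm_divide)
  have "(\<lambda>L. (\<Sum>l\<le>L. q ^ l) / of_nat (Suc L)) \<longlonglongrightarrow> 0"
  proof (rule Lim_null_comparison)
    show "\<forall>\<^sub>F L in sequentially. cmod ((\<Sum>l\<le>L. q ^ l) / of_nat (Suc L)) \<le> 2 / cmod (1 - q) * inverse (real (Suc L))"
    proof (rule always_eventually, rule allI)
      fix L
      have "(\<Sum>l\<le>L. q ^ l) = (1 - q ^ Suc L) / (1 - q)"
        using q sum_gp0[of q L] by simp
      then have "cmod (\<Sum>l\<le>L. q ^ l) \<le> 2 / cmod (1 - q)"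
        using norm_triangle_ineq4[of 1 "q ^ Suc L"] q
        by (simp add: norm_divide norm_power norm_mult divide_right_mono)
      then show "cmod ((\<Sum>l\<le>L. q ^ l) / of_nat (Suc L)) \<le> 2 / cmod (1 - q) * inverse (real (Suc L))"
        unfolding norm_divide norm_of_nat by (simp add: divide_inverse mult_right_mono)
    qed
    show "(\<lambda>L. 2 / cmod (1 - q) * inverse (real (Suc L))) \<longlonglongrightarrow> 0"
      by (rule tendsto_mult_right_zero[OF LIMSEQ_inverse_real_of_nat])
  qed
  then show ?thesis
    using False by (simp add: q_def)
qed

text \<open>If the coefficients at \<open>a, ..., a + L\<close> vanish, then \<open>z powi a\<close> integrates to \<open>0\<close> against
  the average of the powers \<open>(z / w) ^ l\<close>, \<open>l \<le> L\<close>; these averages tend boundedly to the indicator of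
  \<open>{w}\<close>, so the mass at \<open>w\<close> is arbitrarily small.\<close>

lemma continuous_measureI_fourier_gaps:
  assumes \<sigma>: "circle_prob_measure \<sigma>"
    and gaps: "\<And>L::nat. \<exists>a. \<forall>l\<le>L. fourier_coeff \<sigma> (a + int l) = 0"
  shows "continuous_measure \<sigma>"
  unfolding continuous_measure_def
proof
  interpret prob_space \<sigma> using \<sigma> by (simp add: circle_prob_measure_def)
  fix w assume "w \<in> space \<sigma>"
  then have w: "cmod w = 1" "w \<noteq> 0"
    using circle_prob_measure_space[OF \<sigma>] by auto
  have sets: "sets \<sigma> = sets circle_borel"
    using \<sigma> by (simp add: circle_prob_measure_def)
  have w_sets: "{w} \<in> sets \<sigma>"
    unfolding sets using w by (subst sets_restrict_space_iff) auto
  define K :: "nat \<Rightarrow> complex \<Rightarrow> complex"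
    where "K L z = (\<Sum>l\<le>L. (z / w) ^ l) / of_nat (Suc L)" for L z
  define I :: "complex \<Rightarrow> complex" where "I = indicator {w}"
  have I: "integrable \<sigma> I" "I \<in> borel_measurable \<sigma>"
    unfolding I_def using w_sets by (auto intro!: integrable_const_bound[where B = 1] simp: indicator_def)
  have K: "continuous_on unit_circle (K L)" for L
    unfolding K_def using w by (intro continuous_intros) (auto simp del: of_nat_Suc)
  have K_le: "cmod (K L z) \<le> 1" if "cmod z = 1" for L z
  proof -
    have "cmod (\<Sum>l\<le>L. (z / w) ^ l) \<le> real (Suc L)"
      by (rule order.trans[OF sum_norm_le[where g = "\<lambda>_. 1"]]) (use that w in \<open>auto simp: norm_power norm_divide\<close>)
    then show ?thesis
      unfolding K_def norm_divide norm_of_nat by (simp del: of_nat_Suc)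
  qed
  have "(\<lambda>L. \<integral>z. cmod (I z - K L z) \<partial>\<sigma>) \<longlonglongrightarrow> (\<integral>z. 0 \<partial>\<sigma>)"
  proof (rule integral_dominated_convergence[where w = "\<lambda>_. 2"])
    show "(\<lambda>z. cmod (I z - K L z)) \<in> borel_measurable \<sigma>" for L
      using I borel_measurable_circle[OF K sets] by measurable
    show "AE z in \<sigma>. (\<lambda>L. cmod (I z - K L z)) \<longlonglongrightarrow> 0"
    proof (rule AE_I2)
      fix z assume "z \<in> space \<sigma>"
      then have "(\<lambda>L. K L z) \<longlonglongrightarrow> I z"
        unfolding K_def I_def using w circle_prob_measure_space[OF \<sigma>]
        by (intro circle_average_tendsto_indicator) auto
      from tendsto_norm[OF tendsto_diff[OF tendsto_const[of "I z"] this]]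
      show "(\<lambda>L. cmod (I z - K L z)) \<longlonglongrightarrow> 0" by simp
    qed
    show "AE z in \<sigma>. norm (cmod (I z - K L z)) \<le> 2" for L
    proof (rule AE_I2)
      fix z assume "z \<in> space \<sigma>"
      then have "cmod (K L z) \<le> 1"
        using K_le circle_prob_measure_space[OF \<sigma>] by auto
      moreover have "cmod (I z) \<le> 1"
        by (simp add: I_def indicator_def)
      ultimately show "norm (cmod (I z - K L z)) \<le> 2"
        using norm_triangle_ineq4[of "I z" "K L z"] by simp
    qed
  qed auto
  moreover have "measure \<sigma> {w} \<le> (\<integral>z. cmod (I z - K L z) \<partial>\<sigma>)" for L
  proof -
    obtain a where a: "\<And>l. l \<le> L \<Longrightarrow> fourier_coeff \<sigma> (a + int l) = 0"
      using gaps by blast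
    have powi: "continuous_on unit_circle (\<lambda>z. z powi a * K L z)"
      by (intro continuous_intros K)
    have "(\<integral>z. z powi a * K L z \<partial>\<sigma>) = (\<integral>z. (\<Sum>l\<le>L. z powi (a + int l) / (w ^ l * of_nat (Suc L))) \<partial>\<sigma>)"
    proof (rule Bochner_Integration.integral_cong)
      fix z assume "z \<in> space \<sigma>"
      then have "z \<noteq> 0"
        using circle_prob_measure_space[OF \<sigma>] by auto
      then show "z powi a * K L z = (\<Sum>l\<le>L. z powi (a + int l) / (w ^ l * of_nat (Suc L)))"
        by (simp add: K_def power_int_add sum_distrib_left sum_divide_distrib power_divide del: of_nat_Suc)
    qed simp
    also have "\<dots> = (\<Sum>l\<le>L. fourier_coeff \<sigma> (a + int l) / (w ^ l * of_nat (Suc L)))"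
      unfolding fourier_coeff_def
      by (subst Bochner_Integration.integral_sum)
         (intro integrable_divide integrable_circle[OF \<sigma>] continuous_on_circle_powi, simp)
    also have "\<dots> = 0"
      using a by simp
    finally have zero: "(\<integral>z. z powi a * K L z \<partial>\<sigma>) = 0" .
    \<comment> \<open>The indicator freezes the monomial at \<open>w\<close>, leaving a constant of
      modulus \<open>1\<close> that disappears under \<open>cmod\<close>.\<close>
    have Iw: "z powi a * I z = w powi a * I z" for z
      by (simp add: I_def indicator_def)
    have int1: "integrable \<sigma> (\<lambda>z. z powi a * I z)"
      unfolding Iw using I(1) by simp
    have "(\<integral>z. I z \<partial>\<sigma>) = (\<integral>z. of_real (indicator {w} z) \<partial>\<sigma>)"
      unfolding I_def by (intro Bochner_Integration.integral_cong) (auto simp: indicator_def)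
    also have "\<dots> = of_real (measure \<sigma> {w})"
      using w_sets by simp
    finally have "measure \<sigma> {w} = cmod (\<integral>z. w powi a * I z \<partial>\<sigma>)"
      using w by (simp add: norm_mult norm_power_int)
    also have "(\<integral>z. w powi a * I z \<partial>\<sigma>) = (\<integral>z. z powi a * I z - z powi a * K L z \<partial>\<sigma>)"
      using zero int1 integrable_circle[OF \<sigma> powi] by (simp add: Iw)
    also have "cmod \<dots> \<le> (\<integral>z. cmod (z powi a * I z - z powi a * K L z) \<partial>\<sigma>)"
      by (rule integral_norm_bound)
    also have "\<dots> = (\<integral>z. cmod (I z - K L z) \<partial>\<sigma>)"
      using circle_prob_measure_space[OF \<sigma>]
      by (intro Bochner_Integration.integral_cong)
         (auto simp: norm_mult norm_power_int right_diff_distrib[symmetric])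
    finally show ?thesis .
  qed
  ultimately have "measure \<sigma> {w} \<le> 0"
    by (intro LIMSEQ_le_const[where a = "measure \<sigma> {w}"]) auto
  then show "emeasure \<sigma> {w} = 0"
    by (simp add: emeasure_eq_measure measure_le_0_iff)
qed

section \<open>Lebesgue measure on the circle and its Fourier coefficients\<close>

lemma uniform_measure_lborel_Icc:
  fixes a b :: real
  assumes "a < b"
  shows "uniform_measure lborel {a..b} = density lborel (\<lambda>t. ennreal (indicator {a..b} t / (b - a)))"
  unfolding uniform_measure_def
  using assms by (intro density_cong) (auto simp: divide_ennreal[symmetric] indicator_def split: if_splits)

lemma circle_prob_measure_circle_lebesgue: "circle_prob_measure circle_lebesgue"
proof -
  have "prob_space (uniform_measure lborel {0..2 * pi})"
    by (rule prob_space_uniform_measure) auto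
  then show ?thesis
    unfolding circle_lebesgue_def
    by (intro circle_prob_measure_distr_cis)
       (simp add: real_distribution_def real_distribution_axioms_def)
qed

lemma space_circle_lebesgue [simp]: "space circle_lebesgue = unit_circle"
  by (rule circle_prob_measure_space[OF circle_prob_measure_circle_lebesgue])

lemma sets_circle_lebesgue: "sets circle_lebesgue = sets circle_borel"
  using circle_prob_measure_circle_lebesgue by (simp add: circle_prob_measure_def)

lemma fourier_coeff_circle_lebesgue: "fourier_coeff circle_lebesgue s = of_bool (s = 0)"
proof -
  have "fourier_coeff circle_lebesgue s = (\<integral>t. cis t powi s \<partial>uniform_measure lborel {0..2 * pi})"
    unfolding fourier_coeff_def circle_lebesgue_def
    by (intro integral_distr_cis continuous_on_circle_powi) simp
  also have "\<dots> = (\<integral>t. (indicator {0..2 * pi} t / (2 * pi)) *\<^sub>R cis (s * t) \<partial>lborel)"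
    unfolding cis_power_int
    by (subst uniform_measure_lborel_Icc)
       (auto intro!: integral_density borel_measurable_continuous_onI continuous_intros)
  also have "\<dots> = (1 / (2 * pi)) *\<^sub>R (\<integral>t. indicator {0..2 * pi} t *\<^sub>R cis (s * t) \<partial>lborel)"
    by (subst integral_scaleR_right[symmetric]) (simp add: mult.commute)
  also have "(\<integral>t. indicator {0..2 * pi} t *\<^sub>R cis (s * t) \<partial>lborel) = of_real (2 * pi * of_bool (s = 0))"
  proof (cases "s = 0")
    case True
    have "(\<integral>t. indicator {0..2 * pi} t *\<^sub>R (1::complex) \<partial>lborel) = of_real (2 * pi) - of_real 0"
      by (rule integral_FTC_Icc) (auto intro!: derivative_eq_intros continuous_intros)
    with True show ?thesis by simp
  next
    case False
    have "(\<integral>t. indicator {0..2 * pi} t *\<^sub>R cis (s * t) \<partial>lborel) =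
        cis (s * (2 * pi)) / (\<i> * s) - cis (s * (0::real)) / (\<i> * s)"
      by (rule integral_FTC_Icc)
         (use False in \<open>auto intro!: derivative_eq_intros continuous_intros simp: has_vector_derivative_def scaleR_conv_of_real field_simps\<close>)
    moreover have "cis (s * (2 * pi)) = 1"
      using cis_multiple_2pi[of "of_int s"] by (simp add: mult.commute)
    ultimately show ?thesis
      using False by simp
  qed
  finally show ?thesis
    by (auto simp: scaleR_conv_of_real)
qed

section \<open>The extremal polynomials\<close>

text \<open>For \<open>w\<close> supported in \<open>{0..int d}\<close>, this is the coefficient of
  \<open>z powi j\<close> in the squared modulus of the polynomial with coefficients
  \<open>w\<close>. Integer indices let \<open>i - j\<close> leave the support, so the range needs
  no truncation.\<close>

definition autocorr :: "nat \<Rightarrow> (int \<Rightarrow> real) \<Rightarrow> int \<Rightarrow> real" where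
  "autocorr d w j = (\<Sum>i\<in>{0..int d}. w i * w (i - j))"

text \<open>This is the source of nonnegativity of the factors: expand \<open>?S * cnj ?S\<close>
  with \<open>cnj z = inverse z\<close> on the circle and collect terms by the difference of
  exponents.\<close>

lemma trig_poly_autocorr:
  assumes w: "\<And>i. i \<notin> {0..int d} \<Longrightarrow> w i = 0" and z: "cmod z = 1"
  shows "trig_poly d (\<lambda>j. of_real (autocorr d w j)) z =
    of_real ((cmod (\<Sum>i\<in>{0..int d}. of_real (w i) * z powi i))\<^sup>2)"
proof -
  let ?S = "\<Sum>i\<in>{0..int d}. of_real (w i) * z powi i"
  have "z \<noteq> 0" using z by auto
  have "cnj z = inverse z"
    using z complex_mult_cnj[of z] by (simp add: inverse_unique cmod_def)
  then have cnj: "cnj (z powi l) = z powi (- l)" for l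
    by (simp add: power_int_inverse power_int_minus)
  have inner: "(\<Sum>l\<in>{0..int d}. of_real (w l) * z powi (i - l)) =
      (\<Sum>j\<in>{- int d..int d}. of_real (w (i - j)) * z powi j)" if i: "i \<in> {0..int d}" for i
  proof -
    have "(\<Sum>l\<in>{0..int d}. of_real (w l) * z powi (i - l)) =
        (\<Sum>j\<in>{i - int d..i}. of_real (w (i - j)) * z powi j)"
      by (rule sum.reindex_bij_witness[of _ "\<lambda>j. i - j" "\<lambda>l. i - l"]) auto
    also have "\<dots> = (\<Sum>j\<in>{- int d..int d}. of_real (w (i - j)) * z powi j)"
      by (rule sum.mono_neutral_left) (use i w in auto)
    finally show ?thesis .
  qed
  have "of_real ((cmod ?S)\<^sup>2) = ?S * cnj ?S"
    by (rule complex_norm_square)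
  also have "\<dots> = (\<Sum>i\<in>{0..int d}. of_real (w i) * (\<Sum>l\<in>{0..int d}. of_real (w l) * z powi (i - l)))"
    using \<open>z \<noteq> 0\<close> unfolding cnj_sum sum_product
    by (simp add: cnj sum_distrib_left power_int_diff power_int_minus field_simps
        del: complex_cnj_power_int)
  also have "\<dots> = (\<Sum>i\<in>{0..int d}. \<Sum>j\<in>{- int d..int d}. of_real (w i * w (i - j)) * z powi j)"
    by (intro sum.cong refl) (simp add: inner sum_distrib_left mult.assoc)
  also have "\<dots> = trig_poly d (\<lambda>j. of_real (autocorr d w j)) z"
    unfolding trig_poly_def autocorr_def by (subst sum.swap) (simp add: sum_distrib_right)
  finally show ?thesis by simp
qed

text \<open>The maximizer in Fejer's extremal problem: the autocorrelation of this weight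
  has the largest first coefficient among nonnegative trigonometric polynomials of degree \<open>d\<close>
  with constant coefficient \<open>1\<close>.\<close>

definition sine_weight :: "nat \<Rightarrow> int \<Rightarrow> real" where
  "sine_weight d i =
     (if i \<in> {0..int d} then sqrt (2 / (real d + 2)) * sin ((i + 1) * pi / (real d + 2)) else 0)"

text \<open>Two product-to-sum steps: the first splits off the constant \<open>cos y\<close>, and
  the factor \<open>2 * sin x\<close> turns the remaining cosines into differences that
  telescope.\<close>

lemma sum_sin_mult_sin_shift:
  "2 * sin x * (\<Sum>i<K. sin ((real i + 1) * x) * sin ((real i + 1) * x + y)) =
     K * cos y * sin x - (sin ((2 * real K + 1) * x + y) - sin (x + y)) / 2"
proof (induction K)
  case 0
  then show ?case by simp
next
  case (Suc K)
  let ?a = "(real K + 1) * x"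
  have "2 * sin ?a * sin (?a + y) = cos y - cos (2 * ?a + y)"
    using cos_diff[of "?a + y" ?a] cos_add[of "?a + y" ?a] by (simp add: algebra_simps)
  moreover have "2 * sin x * cos (2 * ?a + y) = sin (2 * ?a + y + x) - sin (2 * ?a + y - x)"
    by (simp add: sin_add sin_diff)
  ultimately have "2 * sin x * (sin ?a * sin (?a + y)) =
      cos y * sin x - (sin (2 * ?a + y + x) - sin (2 * ?a + y - x)) / 2"
    by algebra
  moreover have "2 * ?a + y + x = (2 * real (Suc K) + 1) * x + y" "2 * ?a + y - x = (2 * real K + 1) * x + y"
    by (simp_all add: algebra_simps)
  ultimately show ?case
    using Suc.IH by (simp add: algebra_simps add_divide_distrib diff_divide_distrib)
qed

section \<open>Closed form and lower bounds for the extremal coefficients\<close>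

lemma sin_pi_divide_pos: "0 < sin (pi / (real d + 2))"
  by (rule sin_gt_zero) (simp_all add: pos_divide_less_eq)

text \<open>The node spacing satisfies \<open>(real d + 2) * x = pi\<close>, so the upper end of the
  telescoped sum reflects onto the lower end and both contribute \<open>sin ((j + 1) * x)\<close>.
  The argument \<open>- int j\<close> makes the shifts positive.\<close>

lemma autocorr_sine_weight:
  assumes "j \<le> d"
  defines "x \<equiv> pi / (real d + 2)"
  shows "(real d + 2) * autocorr d (sine_weight d) (- int j) =
    (real d + 1 - j) * cos (j * x) + sin ((j + 1) * x) / sin x"
proof -
  have x: "0 < x" "x < pi" "(real d + 2) * x = pi"
    by (simp_all add: x_def pos_divide_less_eq)
  then have "sin x > 0" by (simp add: sin_gt_zero)
  \<comment> \<open>The number of \<open>i\<close> for which both \<open>i\<close> and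
    \<open>i + j\<close> lie in the support.\<close>
  define K where "K = d + 1 - j"
  have "autocorr d (sine_weight d) (- int j) =
      (\<Sum>i\<in>{0..int d - int j}. sine_weight d i * sine_weight d (i + int j))"
    unfolding autocorr_def by (rule sum.mono_neutral_cong_right) (auto simp: sine_weight_def)
  also have "\<dots> = (\<Sum>i<K. sine_weight d (int i) * sine_weight d (int i + int j))"
    by (rule sum.reindex_bij_witness[of _ int nat]) (use assms(1) in \<open>auto simp: K_def\<close>)
  also have "\<dots> = (\<Sum>i<K. 2 / (real d + 2) * (sin ((real i + 1) * x) * sin ((real i + 1) * x + j * x)))"
  proof (rule sum.cong)
    fix i assume "i \<in> {..<K}"
    then have i: "int i \<in> {0..int d}" "int i + int j \<in> {0..int d}"
      by (auto simp: K_def)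
    define q where "q = sqrt (2 / (real d + 2))"
    have q: "2 / (real d + 2) = q * q"
      by (simp add: q_def)
    have "(real i + real j + 1) * pi / (real d + 2) = (real i + 1) * x + j * x"
      "(real i + 1) * pi / (real d + 2) = (real i + 1) * x"
      by (simp_all add: x_def ring_distribs add_divide_distrib)
    with i have "sine_weight d (int i) = q * sin ((real i + 1) * x)"
      "sine_weight d (int i + int j) = q * sin ((real i + 1) * x + j * x)"
      by (simp_all add: sine_weight_def q_def)
    then show "sine_weight d (int i) * sine_weight d (int i + int j) =
        2 / (real d + 2) * (sin ((real i + 1) * x) * sin ((real i + 1) * x + j * x))"
      unfolding q by simp
  qed simp
  finally have "autocorr d (sine_weight d) (- int j) =
      2 / (real d + 2) * (\<Sum>i<K. sin ((real i + 1) * x) * sin ((real i + 1) * x + j * x))"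
    unfolding sum_distrib_left .
  then have eq: "(real d + 2) * autocorr d (sine_weight d) (- int j) =
      2 * (\<Sum>i<K. sin ((real i + 1) * x) * sin ((real i + 1) * x + j * x))"
    by simp
  have "(2 * real K + 1) * x + j * x = 2 * ((real d + 2) * x) - (x + j * x)"
    using assms(1) by (simp add: K_def of_nat_diff algebra_simps)
  then have "sin ((2 * real K + 1) * x + j * x) = - sin (x + j * x)"
    unfolding x(3) by (simp only: sin_2pi_minus)
  then have "sin x * ((real d + 2) * autocorr d (sine_weight d) (- int j)) =
      K * cos (j * x) * sin x + sin (x + j * x)"
    unfolding eq using sum_sin_mult_sin_shift[of x "j * x" K] by (simp add: mult_ac)
  then show ?thesis
    using \<open>sin x > 0\<close> assms(1) by (simp add: K_def of_nat_diff field_simps)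
qed

lemma autocorr_sine_weight_0: "autocorr d (sine_weight d) 0 = 1"
proof -
  have "sin (pi / (real d + 2)) \<noteq> 0"
    using sin_pi_divide_pos[of d] by simp
  then have "(real d + 2) * autocorr d (sine_weight d) 0 = real d + 2"
    using autocorr_sine_weight[of 0 d] by (simp add: add.commute)
  then show ?thesis by simp
qed

text \<open>For \<open>j = 1\<close> the quotient of sines is \<open>2 * cos x\<close>, which
  completes \<open>d * cos x\<close> to the full factor \<open>d + 2\<close>.\<close>

lemma autocorr_sine_weight_1:
  assumes "1 \<le> d"
  shows "autocorr d (sine_weight d) (-1) = cos (pi / (real d + 2))"
proof -
  define x where "x = pi / (real d + 2)"
  have "sin x > 0"
    using sin_pi_divide_pos[of d] by (simp add: x_def add.commute)
  then have "(real d + 2) * autocorr d (sine_weight d) (-1) = (real d + 2) * cos x"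
    using autocorr_sine_weight[of 1 d] assms sin_double[of x]
    unfolding x_def[symmetric] by (simp add: algebra_simps)
  then show ?thesis by (simp add: x_def)
qed

text \<open>A division-free form of \<open>k * sin x \<le> tan (k * x)\<close>. The induction uses
  the addition formula for the sine and bounds \<open>cos (k * x + x)\<close> by
  \<open>cos (k * x) * cos x\<close> for the old terms and by \<open>cos (k * x)\<close> for the new
  one.\<close>

lemma sin_nat_mult_ge:
  fixes x :: real and k :: nat
  assumes "0 \<le> x" "k * x \<le> pi / 2"
  shows "k * sin x * cos (k * x) \<le> sin (k * x)"
  using assms(2)
proof (induction k)
  case 0
  then show ?case by simp
next
  case (Suc k)
  have "0 \<le> k * x" "k * x + x \<le> pi / 2"
    using Suc.prems assms(1) by (simp_all add: algebra_simps)
  then have kx: "0 \<le> k * x" "k * x + x \<le> pi / 2" "k * x \<le> pi / 2" "x \<le> pi / 2"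
    using assms(1) by linarith+
  have nonneg: "sin x \<ge> 0" "sin (k * x) \<ge> 0" "cos x \<ge> 0"
    using kx assms(1) by (auto intro!: sin_ge_zero cos_ge_zero)
  have IH: "k * sin x * cos (k * x) \<le> sin (k * x)"
    using Suc.IH kx by simp
  have mono: "cos (k * x + x) \<le> cos (k * x)"
    using kx assms(1) by (subst cos_mono_le_eq) auto
  have "cos (k * x + x) \<le> cos (k * x) * cos x"
    using nonneg by (simp add: cos_add)
  then have "k * sin x * cos (k * x + x) \<le> k * sin x * (cos (k * x) * cos x)"
    using nonneg by (intro mult_left_mono) auto
  also have "\<dots> \<le> sin (k * x) * cos x"
    using mult_right_mono[OF IH nonneg(3)] by (simp add: mult.assoc)
  finally have "k * sin x * cos (k * x + x) + sin x * cos (k * x + x) \<le> sin (k * x + x)"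
    using mult_left_mono[OF mono nonneg(1)] by (simp add: sin_add mult.commute)
  then show ?case
    by (simp add: algebra_simps)
qed

text \<open>With \<open>k = j - 1\<close>, rewriting \<open>sin ((j + 1) * x)\<close> as
  \<open>sin (k * x) + 2 * cos (j * x) * sin x\<close> gives
  \<open>(d + 2 - k) * cos (j * x) + sin (k * x) / sin x\<close> in the closed form. The last
  quotient makes up for the missing \<open>k * cos (j * x)\<close>.\<close>

lemma autocorr_sine_weight_ge_cos:
  assumes j: "1 \<le> j" "j \<le> d" and half: "j * pi / (real d + 2) \<le> pi / 2"
  shows "cos (j * pi / (real d + 2)) \<le> autocorr d (sine_weight d) (- int j)"
proof -
  define x where "x = pi / (real d + 2)"
  have x: "0 \<le> x" "sin x > 0"
    using sin_pi_divide_pos[of d] by (auto simp: x_def add.commute)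
  have jx: "j * x \<le> pi / 2" "real j * pi / (real d + 2) = j * x"
    using half by (auto simp: x_def)
  then have jx_le: "j * x \<le> pi"
    using pi_gt_zero by linarith
  define k where "k = j - 1"
  have k: "real j = real k + 1"
    using j by (simp add: k_def of_nat_diff)
  have kx: "k * x \<le> j * x" "0 \<le> k * x" "k * x \<le> pi / 2"
    using x(1) jx(1) by (auto simp: k algebra_simps)
  have "k * sin x * cos (j * x) \<le> k * sin x * cos (k * x)"
    using x kx jx_le by (intro mult_left_mono cos_monotone_0_pi_le) auto
  also have "\<dots> \<le> sin (k * x)"
    using sin_nat_mult_ge[OF x(1) kx(3)] .
  finally have "k * cos (j * x) \<le> sin (k * x) / sin x"
    using x(2) by (simp add: field_simps)
  moreover have "sin ((j + 1) * x) / sin x = sin (k * x) / sin x + 2 * cos (j * x)"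
  proof -
    have "sin ((j + 1) * x) = sin (j * x + x)" "sin (k * x) = sin (j * x - x)"
      by (simp_all add: k algebra_simps)
    then have "sin ((j + 1) * x) = sin (k * x) + 2 * cos (j * x) * sin x"
      by (simp add: sin_add sin_diff)
    then show ?thesis
      using x(2) by (simp add: field_simps)
  qed
  ultimately have "(real d + 2) * cos (j * x) \<le> (real d + 2) * autocorr d (sine_weight d) (- int j)"
    using autocorr_sine_weight[OF j(2)]
    unfolding x_def[symmetric] by (simp add: k algebra_simps)
  then show ?thesis
    unfolding jx(2) by (simp add: add_pos_nonneg)
qed

lemma cos_ge_one_minus_square_half: "1 - x\<^sup>2 / 2 \<le> cos (x::real)"
proof -
  have "(sin (x / 2))\<^sup>2 \<le> (x / 2)\<^sup>2"
    using abs_le_square_iff[THEN iffD1, OF abs_sin_x_le_abs_x] .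
  then show ?thesis
    using cos_double_sin[of "x / 2"] by (simp add: power_divide)
qed

section \<open>Riesz products\<close>

lemma continuous_on_trig_poly_powi: "continuous_on unit_circle (\<lambda>z. trig_poly n b (z powi l))"
  unfolding trig_poly_def by (intro continuous_intros) auto

text \<open>The condition \<open>d_pos\<close> makes \<open>total_degree\<close> unbounded, so that
  each frequency is eventually handled by finitely many factors.\<close>

locale riesz_product =
  fixes d :: "nat \<Rightarrow> nat" and c :: "nat \<Rightarrow> int \<Rightarrow> complex" and a :: "nat \<Rightarrow> int"
  assumes nonneg: "\<And>k z. 1 \<le> k \<Longrightarrow> cmod z = 1 \<Longrightarrow> trig_poly (d k) (c k) z \<in> \<real>\<^sub>\<ge>\<^sub>0"
    and c_0: "\<And>k. 1 \<le> k \<Longrightarrow> c k 0 = 1"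
    and d_pos: "\<And>k. 1 \<le> k \<Longrightarrow> 1 \<le> d k"
    and a_pos: "\<And>k. 1 \<le> k \<Longrightarrow> 0 < a k"
    and dissociate: "\<And>k. 1 \<le> k \<Longrightarrow> 1 \<le> a (k + 1) - 2 * (\<Sum>j=1..k. int (d j) * a j)"
begin

abbreviation \<mu> :: "nat \<Rightarrow> complex measure" where
  "\<mu> \<equiv> riesz_partial_product d c a"

definition total_degree :: "nat \<Rightarrow> int" where
  "total_degree N = (\<Sum>k=1..N. int (d k) * a k)"

definition partial_prod :: "nat \<Rightarrow> complex \<Rightarrow> real" where
  "partial_prod N z = (\<Prod>k=1..N. Re (trig_poly (d k) (c k) (z powi a k)))"

lemma total_degree_0 [simp]: "total_degree 0 = 0"
  by (simp add: total_degree_def)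

lemma total_degree_Suc: "total_degree (Suc N) = total_degree N + int (d (Suc N)) * a (Suc N)"
  by (simp add: total_degree_def)

lemma total_degree_nonneg: "0 \<le> total_degree N"
  unfolding total_degree_def by (intro sum_nonneg mult_nonneg_nonneg) (auto intro!: less_imp_le[OF a_pos])

lemma a_Suc_gt: "2 * total_degree N < a (Suc N)"
  \<comment> \<open>Dissociation starts at index \<open>1\<close>; for \<open>N = 0\<close> the
    claim is positivity of \<open>a 1\<close>.\<close>
  using dissociate[of N] a_pos[of "Suc N"] by (cases "N = 0") (auto simp: total_degree_def)

lemma a_Suc_le_total_degree: "a (Suc N) \<le> total_degree (Suc N)"
proof -
  have "1 * a (Suc N) \<le> int (d (Suc N)) * a (Suc N)"
    using d_pos[of "Suc N"] a_pos[of "Suc N"] by (intro mult_right_mono) auto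
  then show ?thesis
    using total_degree_nonneg[of N] by (simp add: total_degree_Suc)
qed

lemma le_total_degree: "int N \<le> total_degree N"
proof (induction N)
  case (Suc N)
  show ?case
  proof (cases N)
    case 0
    then show ?thesis using a_Suc_le_total_degree[of N] a_pos[of 1] by simp
  next
    case (Suc N')
    then show ?thesis
      using Suc.IH a_Suc_le_total_degree[of N] a_Suc_gt[of N] by simp
  qed
qed simp

text \<open>How dissociation is used: around \<open>0\<close> there is a window, containing the
  spectrum of \<open>partial_prod N\<close> and the gap beyond it, that every nonzero multiple of
  \<open>a (Suc N)\<close> moves off that spectrum.\<close>

lemma shift_gt_total_degree:
  assumes "\<bar>s\<bar> < a (Suc N) - total_degree N" "i \<noteq> 0"
  shows "total_degree N < \<bar>s + i * a (Suc N)\<bar>"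
proof -
  have "1 * a (Suc N) \<le> \<bar>i\<bar> * a (Suc N)"
    using assms(2) a_pos[of "Suc N"] by (intro mult_right_mono) auto
  also have "\<dots> = \<bar>i * a (Suc N)\<bar>"
    using a_pos[of "Suc N"] by (simp add: abs_mult)
  finally show ?thesis
    using assms(1) by linarith
qed

lemma continuous_on_partial_prod: "continuous_on unit_circle (partial_prod N)"
  unfolding partial_prod_def by (intro continuous_intros continuous_on_trig_poly_powi)

lemma partial_prod_nonneg: "cmod z = 1 \<Longrightarrow> 0 \<le> partial_prod N z"
  unfolding partial_prod_def
  by (intro prod_nonneg ballI) (use nonneg in \<open>auto simp: norm_power_int complex_nonneg_Reals_iff\<close>)

lemma partial_prod_Suc:
  assumes "cmod z = 1"
  shows "complex_of_real (partial_prod (Suc N) z) =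
    of_real (partial_prod N z) * trig_poly (d (Suc N)) (c (Suc N)) (z powi a (Suc N))"
proof -
  have "of_real (Re w) = w" if "w \<in> \<real>\<^sub>\<ge>\<^sub>0" for w :: complex
    using that by (auto elim!: nonneg_Reals_cases)
  then show ?thesis
    using nonneg[of "Suc N" "z powi a (Suc N)"] assms
    by (simp add: partial_prod_def norm_power_int)
qed

section \<open>Fourier coefficients of the partial products\<close>

lemma integrable_lebesgue_powi:
  "integrable circle_lebesgue (\<lambda>z. of_real (partial_prod N z) * z powi s)"
  by (intro integrable_circle circle_prob_measure_circle_lebesgue continuous_intros
      continuous_on_partial_prod)

lemma fourier_coeff_partial:
  "fourier_coeff (\<mu> N) s = (\<integral>z. of_real (partial_prod N z) * z powi s \<partial>circle_lebesgue)"
proof -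
  have "(\<lambda>z. z powi s) \<in> borel_measurable circle_lebesgue"
    "partial_prod N \<in> borel_measurable circle_lebesgue"
    using sets_circle_lebesgue continuous_on_circle_powi continuous_on_partial_prod
    by (auto intro!: borel_measurable_circle)
  moreover have "AE z in circle_lebesgue. 0 \<le> partial_prod N z"
    using partial_prod_nonneg by (intro AE_I2) simp
  ultimately show ?thesis
    unfolding fourier_coeff_def riesz_partial_product_def partial_prod_def[symmetric]
    by (subst integral_density) (auto simp: scaleR_conv_of_real)
qed

lemma fourier_coeff_partial_0: "fourier_coeff (\<mu> 0) s = of_bool (s = 0)"
  using fourier_coeff_circle_lebesgue[of s]
  unfolding fourier_coeff_partial by (simp add: partial_prod_def fourier_coeff_def)

text \<open>Expanding the new factor gives a convolution. As the coefficient integrates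
  \<open>z powi s\<close>, the term with index \<open>i\<close> pairs with frequency
  \<open>s + i * a (Suc N)\<close>; hence the sign change in \<open>c k (- j k)\<close> later
  on.\<close>

lemma fourier_coeff_partial_Suc:
  "fourier_coeff (\<mu> (Suc N)) s =
    (\<Sum>i\<in>{- int (d (Suc N))..int (d (Suc N))}. c (Suc N) i * fourier_coeff (\<mu> N) (s + i * a (Suc N)))"
proof -
  let ?I = "{- int (d (Suc N))..int (d (Suc N))}"
  have "fourier_coeff (\<mu> (Suc N)) s = (\<integral>z. (\<Sum>i\<in>?I. c (Suc N) i *
      (of_real (partial_prod N z) * z powi (s + i * a (Suc N)))) \<partial>circle_lebesgue)"
    unfolding fourier_coeff_partial
  proof (rule Bochner_Integration.integral_cong)
    fix z assume "z \<in> space circle_lebesgue"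
    then have z: "cmod z = 1" "z \<noteq> 0" by auto
    then show "of_real (partial_prod (Suc N) z) * z powi s = (\<Sum>i\<in>?I. c (Suc N) i *
      (of_real (partial_prod N z) * z powi (s + i * a (Suc N))))"
      unfolding partial_prod_Suc[OF z(1)] trig_poly_def
      by (simp add: sum_distrib_left sum_distrib_right power_int_add power_int_mult[symmetric]
          mult.commute mult.left_commute)
  qed simp
  also have "\<dots> = (\<Sum>i\<in>?I. c (Suc N) i * fourier_coeff (\<mu> N) (s + i * a (Suc N)))"
    unfolding fourier_coeff_partial
    by (subst Bochner_Integration.integral_sum) (auto intro!: integrable_mult_right integrable_lebesgue_powi)
  finally show ?thesis .
qed

lemma fourier_coeff_partial_eq_0:
  "total_degree N < \<bar>s\<bar> \<Longrightarrow> fourier_coeff (\<mu> N) s = 0"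
proof (induction N arbitrary: s)
  case 0
  then show ?case by (auto simp: fourier_coeff_partial_0)
next
  case (Suc N)
  have "fourier_coeff (\<mu> N) (s + i * a (Suc N)) = 0"
    if i: "i \<in> {- int (d (Suc N))..int (d (Suc N))}" for i
  proof (rule Suc.IH)
    have "\<bar>i * a (Suc N)\<bar> \<le> int (d (Suc N)) * a (Suc N)"
      using i a_pos[of "Suc N"] unfolding abs_mult by (intro mult_mono) auto
    then show "total_degree N < \<bar>s + i * a (Suc N)\<bar>"
      using Suc.prems unfolding total_degree_Suc by linarith
  qed
  then show ?case
    by (simp add: fourier_coeff_partial_Suc)
qed

text \<open>Within the window only the term \<open>i = - j\<close> of the convolution meets the old
  spectrum.\<close>

lemma fourier_coeff_partial_Suc_shift:
  assumes s: "\<bar>s\<bar> < a (Suc N) - total_degree N" and j: "\<bar>j\<bar> \<le> int (d (Suc N))"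
  shows "fourier_coeff (\<mu> (Suc N)) (s + j * a (Suc N)) = c (Suc N) (- j) * fourier_coeff (\<mu> N) s"
proof -
  have "fourier_coeff (\<mu> N) (s + j * a (Suc N) + i * a (Suc N)) = 0" if "i \<noteq> - j" for i
    using shift_gt_total_degree[OF s, of "j + i"] that
    by (intro fourier_coeff_partial_eq_0) (simp add: algebra_simps)
  then have "fourier_coeff (\<mu> (Suc N)) (s + j * a (Suc N)) =
      (\<Sum>i\<in>{- int (d (Suc N))..int (d (Suc N))}. if i = - j then c (Suc N) i * fourier_coeff (\<mu> N) s else 0)"
    unfolding fourier_coeff_partial_Suc by (intro sum.cong) auto
  then show ?thesis
    using j by (simp add: abs_le_iff)
qed

text \<open>The shift formula with \<open>j = 0\<close> and \<open>c_0\<close> leaves the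
  coefficient unchanged. The window condition persists, because
  \<open>a (Suc N) \<le> total_degree N'\<close> and \<open>2 * total_degree N' < a (Suc N')\<close>
  for \<open>N' > N\<close>.\<close>

lemma fourier_coeff_partial_stable:
  assumes s: "\<bar>s\<bar> < a (Suc N) - total_degree N" and "N \<le> N'"
  shows "fourier_coeff (\<mu> N') s = fourier_coeff (\<mu> N) s"
  using \<open>N \<le> N'\<close>
proof (induction N' rule: dec_induct)
  case (step N')
  have "\<bar>s\<bar> < a (Suc N') - total_degree N'"
  proof (cases "N' = N")
    case False
    then have "a (Suc N) \<le> total_degree N'"
    proof -
      have mono: "total_degree i \<le> total_degree (Suc i)" for i
        using a_pos[of "Suc i"] by (simp add: total_degree_Suc)
      have "total_degree (Suc N) \<le> total_degree N'"
        using step.hyps False by (intro lift_Suc_mono_le[of total_degree, OF mono]) simp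
      then show ?thesis
        using a_Suc_le_total_degree[of N] by linarith
    qed
    then show ?thesis
      using s a_Suc_gt[of N'] total_degree_nonneg[of N] by linarith
  qed (use s in simp)
  then show ?case
    using fourier_coeff_partial_Suc_shift[of s N' 0] step.IH c_0[of "Suc N'"] by simp
qed simp

lemma abs_sum_le_total_degree:
  assumes "\<And>k. k \<in> {1..N} \<Longrightarrow> \<bar>j k\<bar> \<le> int (d k)"
  shows "\<bar>\<Sum>k=1..N. j k * a k\<bar> \<le> total_degree N"
  unfolding total_degree_def
proof (rule order.trans[OF sum_abs sum_mono])
  fix k assume k: "k \<in> {1..N}"
  then show "\<bar>j k * a k\<bar> \<le> int (d k) * a k"
    using assms[OF k] a_pos[of k] unfolding abs_mult by (intro mult_mono) auto
qed

text \<open>Peel off the last summand: the sum of the earlier ones is at most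
  \<open>total_degree N\<close> in modulus, thus in the window.\<close>

lemma fourier_coeff_partial_sum:
  assumes "\<And>k. k \<in> {1..N} \<Longrightarrow> \<bar>j k\<bar> \<le> int (d k)"
  shows "fourier_coeff (\<mu> N) (\<Sum>k=1..N. j k * a k) = (\<Prod>k=1..N. c k (- j k))"
  using assms
proof (induction N)
  case 0
  then show ?case by (simp add: fourier_coeff_partial_0)
next
  case (Suc N)
  have "\<bar>\<Sum>k=1..N. j k * a k\<bar> < a (Suc N) - total_degree N"
    using abs_sum_le_total_degree[of N j] a_Suc_gt[of N] Suc.prems by fastforce
  then show ?case
    using fourier_coeff_partial_Suc_shift Suc.IH Suc.prems by simp
qed

text \<open>The total mass is the coefficient at \<open>0\<close>, a product of the constants
  \<open>c k 0 = 1\<close>.\<close>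

lemma circle_prob_measure_partial: "circle_prob_measure (\<mu> N)"
proof -
  have meas: "partial_prod N \<in> borel_measurable circle_lebesgue"
    by (intro borel_measurable_circle continuous_on_partial_prod sets_circle_lebesgue)
  have int: "integrable circle_lebesgue (partial_prod N)"
    by (intro integrable_circle circle_prob_measure_circle_lebesgue continuous_on_partial_prod)
  have "of_real (\<integral>z. partial_prod N z \<partial>circle_lebesgue) = fourier_coeff (\<mu> N) 0"
    by (simp add: fourier_coeff_partial)
  also have "\<dots> = 1"
    using fourier_coeff_partial_sum[of N "\<lambda>_. 0"] c_0 by simp
  finally have one: "(\<integral>z. partial_prod N z \<partial>circle_lebesgue) = 1"
    by simp
  have "emeasure (\<mu> N) (space (\<mu> N)) = (\<integral>\<^sup>+z. ennreal (partial_prod N z) \<partial>circle_lebesgue)"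
    unfolding riesz_partial_product_def partial_prod_def[symmetric]
    using meas sets.top[of circle_lebesgue]
    by (subst emeasure_density) (auto intro!: nn_integral_cong simp: indicator_def)
  also have "\<dots> = 1"
    using int one partial_prod_nonneg by (subst nn_integral_eq_integral) (auto intro!: AE_I2)
  finally show ?thesis
    unfolding circle_prob_measure_def
    by (auto intro!: prob_spaceI simp: riesz_partial_product_def sets_circle_lebesgue)
qed

lemma ex_limit:
  obtains \<sigma> where "circle_prob_measure \<sigma>" "weak_star_limit \<mu> \<sigma>"
    "\<And>N s. \<bar>s\<bar> < a (Suc N) - total_degree N \<Longrightarrow> fourier_coeff \<sigma> s = fourier_coeff (\<mu> N) s"
proof -
  have lim: "(\<lambda>N'. fourier_coeff (\<mu> N') s) \<longlonglongrightarrow> fourier_coeff (\<mu> N) s"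
    if "\<bar>s\<bar> < a (Suc N) - total_degree N" for N s
    by (intro tendsto_eventually eventually_sequentiallyI[of N] fourier_coeff_partial_stable[OF that])
  have "convergent (\<lambda>N. fourier_coeff (\<mu> N) s)" for s
  proof -
    \<comment> \<open>The choice \<open>N = nat \<bar>s\<bar>\<close> works since
      \<open>int N \<le> total_degree N\<close> and \<open>a (Suc N)\<close> exceeds twice
      \<open>total_degree N\<close>.\<close>
    have "\<bar>s\<bar> < a (Suc (nat \<bar>s\<bar>)) - total_degree (nat \<bar>s\<bar>)"
      using le_total_degree[of "nat \<bar>s\<bar>"] a_Suc_gt[of "nat \<bar>s\<bar>"] by simp
    then show ?thesis
      unfolding convergent_def by (intro exI) (rule lim)
  qed
  then obtain \<sigma> where \<sigma>: "circle_prob_measure \<sigma>" "weak_star_limit \<mu> \<sigma>"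
    by (rule ex_weak_star_limit[OF circle_prob_measure_partial])
  show ?thesis
    using that[OF \<sigma>] LIMSEQ_unique[OF weak_star_limit_fourier_coeff[OF \<sigma>(2)] lim] by simp
qed

section \<open>Coefficients and continuity of the limit measure\<close>

context
  fixes \<sigma>
  assumes \<sigma>: "circle_prob_measure \<sigma>"
    and coeff: "\<And>N s. \<bar>s\<bar> < a (Suc N) - total_degree N \<Longrightarrow> fourier_coeff \<sigma> s = fourier_coeff (\<mu> N) s"
begin

lemma fourier_coeff_limit_sum:
  assumes F: "finite F" "F \<noteq> {}" "F \<subseteq> {1..}" and j: "\<And>k. k \<in> F \<Longrightarrow> \<bar>j k\<bar> \<le> int (d k)"
  shows "fourier_coeff \<sigma> (\<Sum>k\<in>F. j k * a k) = (\<Prod>k\<in>F. c k (- j k))"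
proof -
  define N where "N = Max F"
  \<comment> \<open>Padding by \<open>0\<close> reduces to a full initial segment; the added factors
    are \<open>c k 0 = 1\<close>.\<close>
  define j' where "j' k = (if k \<in> F then j k else 0)" for k
  have sub: "F \<subseteq> {1..N}"
    using F by (auto simp: N_def)
  have j': "\<bar>j' k\<bar> \<le> int (d k)" for k
    using j by (simp add: j'_def)
  have "(\<Sum>k\<in>F. j k * a k) = (\<Sum>k=1..N. j' k * a k)"
    using sub by (intro sum.mono_neutral_cong_left) (auto simp: j'_def)
  moreover have "\<bar>\<Sum>k=1..N. j' k * a k\<bar> < a (Suc N) - total_degree N"
    using abs_sum_le_total_degree[of N j'] j' a_Suc_gt[of N] by fastforce
  moreover have "(\<Prod>k=1..N. c k (- j' k)) = (\<Prod>k\<in>F. c k (- j k))"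
    using sub c_0 by (intro prod.mono_neutral_cong_right) (auto simp: j'_def)
  ultimately show ?thesis
    using coeff fourier_coeff_partial_sum[of N j'] j' by simp
qed

lemma continuous_measure_limit:
  assumes "filterlim (\<lambda>N. a (Suc N) - 2 * total_degree N) at_top sequentially"
  shows "continuous_measure \<sigma>"
proof (rule continuous_measureI_fourier_gaps[OF \<sigma>])
  fix L :: nat
  \<comment> \<open>The margin \<open>2\<close> keeps the last frequency
    \<open>total_degree N + 1 + int L\<close> strictly below
    \<open>a (Suc N) - total_degree N\<close>, while the first lies just above the spectrum.\<close>
  have "\<forall>\<^sub>F N in sequentially. int L + 2 \<le> a (Suc N) - 2 * total_degree N"
    using assms by (auto simp: filterlim_at_top)
  then obtain N where N: "int L + 2 \<le> a (Suc N) - 2 * total_degree N"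
    by (auto simp: eventually_sequentially)
  have "fourier_coeff \<sigma> (total_degree N + 1 + int l) = 0" if "l \<le> L" for l
    using that N total_degree_nonneg[of N]
    by (subst coeff[of _ N]) (auto intro!: fourier_coeff_partial_eq_0)
  then show "\<exists>b. \<forall>l\<le>L. fourier_coeff \<sigma> (b + int l) = 0"
    by blast
qed

end

end

section \<open>The Riesz product built from the extremal factors along \<open>n\<close>\<close>

theorem proposition3p1:
  fixes n m p :: "nat \<Rightarrow> int"
  assumes "strict_mono_on {1..} n"
    and "\<forall>k\<ge>1. n k > 0"
    and "strict_mono_on {1..} m"
    and "\<forall>k\<ge>1. n (k + 1) - 2 * (\<Sum>j=1..k. m j * n j) \<ge> 1"
    and "filterlim (\<lambda>k. n (k + 1) - 2 * (\<Sum>j=1..k. m j * n j)) at_top sequentially"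
    and "\<forall>k\<ge>1. p k \<ge> 1 \<and> real_of_int (p k) * pi \<le> real_of_int (m k) + 2"
  shows "\<exists>\<sigma>. generalized_riesz_product \<sigma> \<and> continuous_measure \<sigma> \<and>
    (\<forall>F. finite F \<and> F \<noteq> {} \<and> F \<subseteq> {1..} \<longrightarrow>
      (\<forall>j :: nat \<Rightarrow> int. (\<forall>k\<in>F. j k \<in> {1..p k}) \<longrightarrow>
         fourier_coeff \<sigma> (\<Sum>k\<in>F. j k * n k) \<in> \<real> \<and>
         Re (fourier_coeff \<sigma> (\<Sum>k\<in>F. j k * n k)) \<ge>
           (\<Prod>k\<in>F. max 0 (1 - 3 * pi\<^sup>2 * (real_of_int (p k) / (real_of_int (m k) + 2))\<^sup>2))) \<and>
      fourier_coeff \<sigma> (\<Sum>k\<in>F. n k) =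
        complex_of_real (\<Prod>k\<in>F. cos (pi / (real_of_int (m k) + 2))))"
proof -
  note a_strict = assms(1) and a_pos = assms(2) and dissociate = assms(4) and a_gap = assms(5)
  have p: "1 \<le> p k" "real_of_int (p k) * pi \<le> real_of_int (m k) + 2" if "1 \<le> k" for k
    using assms(6) that by auto
  \<comment> \<open>As \<open>p k \<ge> 1\<close>, this gives \<open>1 \<le> p k \<le> m k\<close>:
    the degree \<open>nat (m k)\<close> is faithful and every admissible \<open>j k\<close> lies in
    the spectrum of its factor.\<close>
  have p3: "3 * p k \<le> m k + 2" if "1 \<le> k" for k
  proof -
    have "real_of_int (p k) * 3 \<le> real_of_int (p k) * pi"
      using p(1)[OF that] pi_gt3 by (intro mult_left_mono) auto
    then show ?thesis
      using p(2)[OF that] by linarith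
  qed
  define d where "d k = nat (m k)" for k
  have d: "int (d k) = m k" "1 \<le> d k" "p k \<le> int (d k)" if "1 \<le> k" for k
    using p(1)[OF that] p3[OF that] by (auto simp: d_def)
  have d_real: "real (d k) = real_of_int (m k)" if "1 \<le> k" for k
    using d(1)[OF that] by (metis of_int_of_nat_eq)
  define r where "r k = autocorr (d k) (sine_weight (d k))" for k
  define c where "c k j = complex_of_real (r k j)" for k j
  have deg: "(\<Sum>j=1..k. int (d j) * n j) = (\<Sum>j=1..k. m j * n j)" for k
    using d(1) by (intro sum.cong) auto
  have nonneg: "trig_poly (d k) (c k) z \<in> \<real>\<^sub>\<ge>\<^sub>0" if "cmod z = 1" for k z
    unfolding c_def r_def using that
    by (subst trig_poly_autocorr) (auto simp: sine_weight_def)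
  interpret riesz_product d c n
  proof
    show "c k 0 = 1" for k
      by (simp add: c_def r_def autocorr_sine_weight_0)
  qed (use nonneg d a_pos dissociate in \<open>auto simp: deg\<close>)
  obtain \<sigma> where \<sigma>: "circle_prob_measure \<sigma>" "weak_star_limit \<mu> \<sigma>"
    and coeff: "\<And>N s. \<bar>s\<bar> < n (Suc N) - total_degree N \<Longrightarrow>
      fourier_coeff \<sigma> s = fourier_coeff (\<mu> N) s"
    using ex_limit by metis
  have "generalized_riesz_product \<sigma>"
    unfolding generalized_riesz_product_def
    using \<sigma> nonneg c_0 a_strict a_pos dissociate
    by (intro conjI exI[of _ d] exI[of _ c] exI[of _ n]) (auto simp: deg)
  moreover have "continuous_measure \<sigma>"
    using a_gap deg by (intro continuous_measure_limit[OF \<sigma>(1) coeff]) (simp_all add: total_degree_def)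
  moreover have "fourier_coeff \<sigma> (\<Sum>k\<in>F. j k * n k) \<in> \<real> \<and>
      (\<Prod>k\<in>F. max 0 (1 - 3 * pi\<^sup>2 * (real_of_int (p k) / (real_of_int (m k) + 2))\<^sup>2))
        \<le> Re (fourier_coeff \<sigma> (\<Sum>k\<in>F. j k * n k))"
    if F: "finite F" "F \<noteq> {}" "F \<subseteq> {1..}" and j: "\<forall>k\<in>F. j k \<in> {1..p k}" for F j
  proof -
    have F1: "1 \<le> k" if "k \<in> F" for k
      using F(3) that by auto
    have "\<bar>j k\<bar> \<le> int (d k)" if "k \<in> F" for k
      using j d(3)[OF F1[OF that]] that by fastforce
    then have eq: "fourier_coeff \<sigma> (\<Sum>k\<in>F. j k * n k) = of_real (\<Prod>k\<in>F. r k (- j k))"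
      using fourier_coeff_limit_sum[OF \<sigma>(1) coeff F] by (simp add: c_def)
    have "max 0 (1 - 3 * pi\<^sup>2 * (real_of_int (p k) / (real_of_int (m k) + 2))\<^sup>2) \<le> r k (- j k)"
      if "k \<in> F" for k
    proof -
      define x where "x = real_of_int (j k) * pi / (real (d k) + 2)"
      define y where "y = real_of_int (p k) * pi / (real (d k) + 2)"
      have jk: "1 \<le> j k" "j k \<le> p k"
        using j that by auto
      have xy: "0 \<le> x" "x \<le> y" "y \<le> 1"
        using jk p(2)[OF F1[OF that]] d_real[OF F1[OF that]]
        by (auto simp: x_def y_def divide_right_mono)
      then have sq: "x\<^sup>2 \<le> y\<^sup>2" "x\<^sup>2 \<le> 1"
        by (auto simp: power_mono power_le_one)
      have y2: "pi\<^sup>2 * (real_of_int (p k) / (real_of_int (m k) + 2))\<^sup>2 = y\<^sup>2"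
        using d_real[OF F1[OF that]] by (simp add: y_def power_divide power_mult_distrib)
      \<comment> \<open>Both parts of the maximum are covered: \<open>x\<^sup>2 \<le> 1\<close>
        keeps the right side positive, and \<open>x\<^sup>2 \<le> y\<^sup>2\<close> handles the
        other bound.\<close>
      have "max 0 (1 - 3 * y\<^sup>2) \<le> 1 - x\<^sup>2 / 2"
        using sq zero_le_power2[of y] by linarith
      also have "\<dots> \<le> cos x"
        by (rule cos_ge_one_minus_square_half)
      also have "\<dots> \<le> r k (- j k)"
      proof -
        have "x \<le> pi / 2"
          using xy pi_gt3 by linarith
        then show ?thesis
          using autocorr_sine_weight_ge_cos[of "nat (j k)" "d k"] jk d(3)[OF F1[OF that]]
          by (simp add: r_def x_def nat_le_iff)
      qed
      finally show ?thesis
        unfolding y2[symmetric] by (simp only: mult.assoc)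
    qed
    \<comment> \<open>Taking positive parts makes the lower bounds nonnegative, which is what allows
      them to be multiplied.\<close>
    then have "(\<Prod>k\<in>F. max 0 (1 - 3 * pi\<^sup>2 * (real_of_int (p k) / (real_of_int (m k) + 2))\<^sup>2))
        \<le> (\<Prod>k\<in>F. r k (- j k))"
      by (intro prod_mono) auto
    then show ?thesis
      unfolding eq Re_complex_of_real by (intro conjI Reals_of_real)
  qed
  moreover have "fourier_coeff \<sigma> (\<Sum>k\<in>F. n k) =
      complex_of_real (\<Prod>k\<in>F. cos (pi / (real_of_int (m k) + 2)))"
    if F: "finite F" "F \<noteq> {}" "F \<subseteq> {1..}" for F
  proof -
    have F1: "1 \<le> k" if "k \<in> F" for k
      using F(3) that by auto
    have "fourier_coeff \<sigma> (\<Sum>k\<in>F. 1 * n k) = (\<Prod>k\<in>F. c k (- 1))"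
      using d(2) F1 by (intro fourier_coeff_limit_sum[OF \<sigma>(1) coeff F]) fastforce+
    also have "\<dots> = (\<Prod>k\<in>F. complex_of_real (cos (pi / (real_of_int (m k) + 2))))"
      using F1 d(2) d_real by (intro prod.cong) (simp_all add: c_def r_def autocorr_sine_weight_1)
    finally show ?thesis by simp
  qed
  ultimately show ?thesis
    by blast
qed

end
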